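(* Let $C=C(\{C_s\}_{s\in S})\subseteq\Sigma^n$ be a lifted code such that all the codes $C_s$ have the same cardinality, and let $L\subseteq\prod_{s\in S}C_s$ be its line code. Let $\eta\in[0,\frac12\delta(L)]$ and suppose that $L$ has a decoding algorithm for words that are $\eta$-close to $L$. Then $C$ has a decoding algorithm for words that are $\frac{D_{\min}}{D_{\max}k_{\max}}\eta$-close to $C$. Provided that $k_{\max}=O(1)$ (as a function of $n$), its time complexity is $O(n+|S|)$ plus the time complexity of the decoding algorithm for $L$.
   Context: $\Sigma$ is a finite alphabet, $[n]=\{1,\dots,n\}$; $\mathrm{dist}$ denotes normalized Hamming distance (also on $\prod_{s\in S}C_s$, counting coordinates $s$). **Lifted code.** $S$ is a collection of subsets of $[n]$ with $\bigcup_{s\in S}s=[n]$ and $C_s\subseteq\Sigma^s$ is a nonempty code for each $s\in S$; $C(\{C_s\}_{s\in S})=\{g\in\Sigma^n:g|_s\in C_s\ \forall s\in S\}$. **Line code.** $L=\{(f_s)_{s\in S}\in\prod_{s\in S}C_s:f_s|_{s\cap s'}=f_{s'}|_{s\cap s'}\ \forall s,s'\in S\}$; identifying each $C_s$ with a fixed set $\Sigma'$, it is a code inside $\Sigma'^S$. **Distance, decoding.** $\delta(D)=\min\{\mathrm{dist}(f,g):f\ne g\in D\}$. $f$ is $\eta$-close to $D$ if $\mathrm{dist}(f,D)<\eta$; a decoding algorithm for words $\eta$-close to $D$ takes such $f$ and outputs the unique $f'\in D$ with $\mathrm{dist}(f,f')<\eta$. **Constants.** $k_{\max}=\max_{s\in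 S}|s|$, $D_{\min}=\min_{i\in[n]}\#\{s\in S:i\in s\}$, $D_{\max}=\max_{i\in[n]}\#\{s\in S:i\in s\}$. *)

theory Defs
  imports Complex_Main "HOL-Library.FuncSet" "HOL-Library.Extended_Real"
begin

section \<open>Codes and distances\<close>

text \<open>
  A word with coordinate set \<open>I\<close> is an extensional function on \<open>I\<close>; thus \<open>\<Sigma>\<^sup>n\<close> is
  \<open>{1..n} \<rightarrow>\<^sub>E UNIV\<close>, where the finite alphabet \<open>\<Sigma>\<close> is a type of class \<open>finite\<close>.
\<close>

definition hdist :: "'k set \<Rightarrow> ('k \<Rightarrow> 'b) \<Rightarrow> ('k \<Rightarrow> 'b) \<Rightarrow> real" where
  "hdist I f g = real (card {x\<in>I. f x \<noteq> g x}) / real (card I)"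

text \<open>Both infima are minima for finite nonempty index sets, and \<open>\<infinity>\<close> when nothing is left to
  minimise over (codes with at most one word, respectively the empty code).\<close>

definition code_dist :: "'k set \<Rightarrow> ('k \<Rightarrow> 'b) set \<Rightarrow> ereal" where
  "code_dist I D = Inf {ereal (hdist I f g) |f g. f \<in> D \<and> g \<in> D \<and> f \<noteq> g}"

definition dist_to_code :: "'k set \<Rightarrow> ('k \<Rightarrow> 'b) \<Rightarrow> ('k \<Rightarrow> 'b) set \<Rightarrow> ereal" where
  "dist_to_code I f D = Inf {ereal (hdist I f g) |g. g \<in> D}"

definition close_to_code :: "real \<Rightarrow> 'k set \<Rightarrow> ('k \<Rightarrow> 'b) set \<Rightarrow> ('k \<Rightarrow> 'b) \<Rightarrow> bool" where
  "close_to_code \<eta> I D f \<longleftrightarrow> dist_to_code I f D < ereal \<eta>"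

section \<open>Lifted codes and line codes\<close>

definition lifted_code_data :: "nat \<Rightarrow> nat set set \<Rightarrow> (nat set \<Rightarrow> (nat \<Rightarrow> 'a::finite) set) \<Rightarrow> bool" where
  "lifted_code_data n S C \<longleftrightarrow>
     n \<ge> 1 \<and> \<Union> S = {1..n} \<and> (\<forall>s\<in>S. C s \<noteq> {} \<and> C s \<subseteq> (s \<rightarrow>\<^sub>E UNIV))"

definition lifted_code :: "nat \<Rightarrow> nat set set \<Rightarrow> (nat set \<Rightarrow> (nat \<Rightarrow> 'a) set) \<Rightarrow> (nat \<Rightarrow> 'a) set" where
  "lifted_code n S C = {g \<in> {1..n} \<rightarrow>\<^sub>E UNIV. \<forall>s\<in>S. restrict g s \<in> C s}"

definition line_code :: "nat set set \<Rightarrow> (nat set \<Rightarrow> (nat \<Rightarrow> 'a) set) \<Rightarrow> (nat set \<Rightarrow> nat \<Rightarrow> 'a) set" where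
  "line_code S C = {h \<in> PiE S C. \<forall>s\<in>S. \<forall>s'\<in>S. restrict (h s) (s \<inter> s') = restrict (h s') (s \<inter> s')}"

definition k_max :: "nat set set \<Rightarrow> nat" where
  "k_max S = Max (card ` S)"

definition D_min :: "nat \<Rightarrow> nat set set \<Rightarrow> nat" where
  "D_min n S = Min ((\<lambda>i. card {s\<in>S. i \<in> s}) ` {1..n})"

definition D_max :: "nat \<Rightarrow> nat set set \<Rightarrow> nat" where
  "D_max n S = Max ((\<lambda>i. card {s\<in>S. i \<in> s}) ` {1..n})"

section \<open>The model of computation\<close>

text \<open>
  Algorithms are programs for a random access machine with addition and truncated subtraction.
  Its working memory consists of banks of cells that hold natural numbers. It also has random
  read-only access to a listing of the lifted code at hand: the sets are numbered from \<open>0\<close>, and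
  so are the elements of each set \<open>s\<close> and the words of each \<open>C\<^sub>s\<close>. The field \<open>hint\<close> holds
  arbitrary further data on which a decoder may rely (constantly \<open>0\<close> if there are none).
\<close>

record listing =
  word_length :: nat
  num_sets :: nat
  set_size :: "nat \<Rightarrow> nat"
  num_words :: "nat \<Rightarrow> nat"
  element :: "nat \<Rightarrow> nat \<Rightarrow> nat"
  letter :: "nat \<Rightarrow> nat \<Rightarrow> nat \<Rightarrow> nat"
  hint :: "nat \<Rightarrow> nat"

type_synonym memory = "nat \<Rightarrow> nat \<Rightarrow> nat"

datatype expr =
    Const nat
  | Cell nat expr
  | Plus expr expr
  | Minus expr expr
  | WordLength
  | NumSets
  | SetSize expr
  | NumWords expr
  | Element expr expr
  | Letter expr expr expr
  | Hint expr

primrec val :: "listing \<Rightarrow> memory \<Rightarrow> expr \<Rightarrow> nat" where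
  "val R M (Const k) = k"
| "val R M (Cell b e) = M b (val R M e)"
| "val R M (Plus e e') = val R M e + val R M e'"
| "val R M (Minus e e') = val R M e - val R M e'"
| "val R M WordLength = word_length R"
| "val R M NumSets = num_sets R"
| "val R M (SetSize e) = set_size R (val R M e)"
| "val R M (NumWords e) = num_words R (val R M e)"
| "val R M (Element e e') = element R (val R M e) (val R M e')"
| "val R M (Letter e e' e'') = letter R (val R M e) (val R M e') (val R M e'')"
| "val R M (Hint e) = hint R (val R M e)"

primrec cost :: "expr \<Rightarrow> nat" where
  "cost (Const k) = 1"
| "cost (Cell b e) = cost e + 1"
| "cost (Plus e e') = cost e + cost e' + 1"
| "cost (Minus e e') = cost e + cost e' + 1"
| "cost WordLength = 1"
| "cost NumSets = 1"
| "cost (SetSize e) = cost e + 1"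
| "cost (NumWords e) = cost e + 1"
| "cost (Element e e') = cost e + cost e' + 1"
| "cost (Letter e e' e'') = cost e + cost e' + cost e'' + 1"
| "cost (Hint e) = cost e + 1"

datatype program =
    Store nat expr expr
  | Seq program program
  | Cond expr program program
  | While expr program

text \<open>\<open>exec R P M t M'\<close>: started in memory \<open>M\<close>, the program \<open>P\<close> halts after exactly \<open>t\<close> steps in
  memory \<open>M'\<close>. The address in \<open>Store\<close> is bank \<open>b\<close>, cell \<open>e\<close>; nonzero conditions count as true.\<close>

inductive exec :: "listing \<Rightarrow> program \<Rightarrow> memory \<Rightarrow> nat \<Rightarrow> memory \<Rightarrow> bool" for R where
  Store: "exec R (Store b e e') M (cost e + cost e' + 1)
            (M(b := (M b)(val R M e := val R M e')))"
| Seq: "exec R P M t M' \<Longrightarrow> exec R Q M' t' M'' \<Longrightarrow> exec R (Seq P Q) M (t + t') M''"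
| CondTrue: "val R M e \<noteq> 0 \<Longrightarrow> exec R P M t M' \<Longrightarrow> exec R (Cond e P Q) M (cost e + 1 + t) M'"
| CondFalse: "val R M e = 0 \<Longrightarrow> exec R Q M t M' \<Longrightarrow> exec R (Cond e P Q) M (cost e + 1 + t) M'"
| WhileFalse: "val R M e = 0 \<Longrightarrow> exec R (While e P) M (cost e + 1) M"
| WhileTrue: "val R M e \<noteq> 0 \<Longrightarrow> exec R P M t M' \<Longrightarrow> exec R (While e P) M' t' M'' \<Longrightarrow>
    exec R (While e P) M (cost e + 1 + t + t') M''"

lemma exec_deterministic:
  "exec R P M t M' \<Longrightarrow> exec R P M u N \<Longrightarrow> u = t \<and> N = M'"
proof (induction arbitrary: u N rule: exec.induct)
  case (Store b e e' M)
  from Store.prems show ?case by cases simp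
next
  case (Seq P M t M' Q t' M'')
  note IH = Seq.IH
  from Seq.prems show ?case
  proof cases
    case (Seq t1 M1 t2)
    with IH(1)[of t1 M1] IH(2)[of t2 N] show ?thesis by simp
  qed
next
  case (CondTrue M e P t M' Q)
  note IH = CondTrue.IH and hyps = CondTrue.hyps
  from CondTrue.prems show ?case
  proof cases
    case (CondTrue t1)
    with IH[of t1 N] show ?thesis by simp
  qed (use hyps in simp)
next
  case (CondFalse M e Q t M' P)
  note IH = CondFalse.IH and hyps = CondFalse.hyps
  from CondFalse.prems show ?case
  proof cases
    case (CondFalse t1)
    with IH[of t1 N] show ?thesis by simp
  qed (use hyps in simp)
next
  case (WhileFalse M e P)
  from WhileFalse.prems show ?case by cases (use WhileFalse.hyps in simp_all)
next
  case (WhileTrue M e P t M' t' M'')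
  note IH = WhileTrue.IH and hyps = WhileTrue.hyps
  from WhileTrue.prems show ?case
  proof cases
    case (WhileTrue t1 M1 t2)
    with IH(1)[of t1 M1] IH(2)[of t2 N] show ?thesis by simp
  qed (use hyps in simp)
qed

text \<open>The input is in the first cells of bank \<open>0\<close>, all other cells being \<open>0\<close>; the output is expected
  in the first cells of bank \<open>1\<close>.\<close>

definition initial_memory :: "nat list \<Rightarrow> memory" where
  "initial_memory xs = (\<lambda>b a. if b = 0 \<and> a < length xs then xs ! a else 0)"

definition has_output :: "memory \<Rightarrow> nat list \<Rightarrow> bool" where
  "has_output M ys \<longleftrightarrow> (\<forall>a<length ys. M 1 a = ys ! a)"

text \<open>
  \<open>P\<close> is a decoding algorithm for words of \<open>X\<close> that are \<open>\<eta>\<close>-close to \<open>D\<close>, of worst-case time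
  complexity at most \<open>t\<close>; words are presented to the machine by means of \<open>enc\<close>.
\<close>

definition decodes_within ::
  "listing \<Rightarrow> program \<Rightarrow> 'k set \<Rightarrow> ('k \<Rightarrow> 'b) set \<Rightarrow> ('k \<Rightarrow> 'b) set \<Rightarrow>
   (('k \<Rightarrow> 'b) \<Rightarrow> nat list) \<Rightarrow> real \<Rightarrow> nat \<Rightarrow> bool" where
  "decodes_within R P I X D enc \<eta> t \<longleftrightarrow>
     (\<forall>f\<in>X. close_to_code \<eta> I D f \<longrightarrow>
        (\<exists>f'\<in>D. hdist I f f' < \<eta> \<and> (\<forall>g\<in>D. hdist I f g < \<eta> \<longrightarrow> g = f') \<and>
           (\<exists>u\<le>t. \<exists>M. exec R P (initial_memory (enc f)) u M \<and> has_output M (enc f'))))"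

section \<open>Presentation of lifted codes and words to the machine\<close>

text \<open>
  The members of \<open>S\<close> are numbered by a list \<open>ss\<close>, the words of \<open>C\<^sub>s\<close> by a list \<open>cs s\<close>, and the
  letters by \<open>\<alpha>\<close>. The second numbering is the identification of \<open>C\<^sub>s\<close> with a fixed set \<open>\<Sigma>'\<close>,
  namely \<open>{0..<q}\<close> if all \<open>C\<^sub>s\<close> have cardinality \<open>q\<close>.
\<close>

definition enumerates ::
  "nat set list \<Rightarrow> (nat set \<Rightarrow> (nat \<Rightarrow> 'a) list) \<Rightarrow> nat set set \<Rightarrow> (nat set \<Rightarrow> (nat \<Rightarrow> 'a) set) \<Rightarrow> bool"
  where
  "enumerates ss cs S C \<longleftrightarrow> distinct ss \<and> set ss = S \<and>
     (\<forall>s\<in>S. distinct (cs s) \<and> set (cs s) = C s)"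

definition position :: "'b list \<Rightarrow> 'b \<Rightarrow> nat" where
  "position xs x = (THE j. j < length xs \<and> xs ! j = x)"

definition listing_of ::
  "('a \<Rightarrow> nat) \<Rightarrow> nat \<Rightarrow> nat set list \<Rightarrow> (nat set \<Rightarrow> (nat \<Rightarrow> 'a) list) \<Rightarrow> (nat \<Rightarrow> nat) \<Rightarrow> listing"
  where
  "listing_of \<alpha> n ss cs aux = \<lparr>
     word_length = n,
     num_sets = length ss,
     set_size = (\<lambda>j. if j < length ss then card (ss ! j) else 0),
     num_words = (\<lambda>j. if j < length ss then length (cs (ss ! j)) else 0),
     element = (\<lambda>j p. if j < length ss \<and> p < card (ss ! j)
                      then sorted_list_of_set (ss ! j) ! p else 0),
     letter = (\<lambda>j c p. if j < length ss \<and> c < length (cs (ss ! j)) \<and> p < card (ss ! j)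
                       then \<alpha> ((cs (ss ! j) ! c) (sorted_list_of_set (ss ! j) ! p)) else 0),
     hint = aux \<rparr>"

definition enc_word :: "('a \<Rightarrow> nat) \<Rightarrow> nat \<Rightarrow> (nat \<Rightarrow> 'a) \<Rightarrow> nat list" where
  "enc_word \<alpha> n f = map (\<lambda>i. \<alpha> (f i)) [1..<Suc n]"

definition enc_line_word ::
  "nat set list \<Rightarrow> (nat set \<Rightarrow> (nat \<Rightarrow> 'a) list) \<Rightarrow> (nat set \<Rightarrow> nat \<Rightarrow> 'a) \<Rightarrow> nat list" where
  "enc_line_word ss cs h = map (\<lambda>s. position (cs s) (h s)) ss"

end

theory Submission
  imports Defs
begin

text \<open>
  Replace a received word \<open>f\<close> by the tuple whose entry at \<open>s\<close> is \<open>f|\<^sub>s\<close> when this lies in \<open>C\<^sub>s\<close>, and an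
  arbitrary word of \<open>C\<^sub>s\<close> otherwise. Each wrong coordinate of \<open>f\<close> spoils at most \<open>D\<^sub>m\<^sub>a\<^sub>x\<close> entries, and
  double counting incidences gives \<open>n D\<^sub>m\<^sub>i\<^sub>n \<le> |S| k\<^sub>m\<^sub>a\<^sub>x\<close>; so the tuple is \<open>\<eta>\<close>-close to the line word
  of the codeword close to \<open>f\<close>. The decoder for \<open>L\<close> recovers this line word, from which the letters of
  the codeword are read off. The decoder for \<open>L\<close> must be started in its own initial memory, so
  all working cells are wiped before it is called.
\<close>

section \<open>Combinatorics: the distance estimate and the embedding of the lifted code into the
  line code\<close>

section \<open>From words to line words\<close>

lemma finite_lifted_code_data:
  assumes "lifted_code_data n S C"
  shows "finite S" "\<And>s. s \<in> S \<Longrightarrow> finite s \<and> s \<subseteq> {1..n}"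
proof -
  have sub: "s \<subseteq> {1..n}" if "s \<in> S" for s
    using assms that by (auto simp: lifted_code_data_def)
  then have "S \<subseteq> Pow {1..n}" by blast
  then show "finite S" by (rule finite_subset) simp
  show "finite s \<and> s \<subseteq> {1..n}" if "s \<in> S" for s
    using sub[OF that] finite_subset by blast
qed

lemma lifted_code_data_cover:
  assumes "lifted_code_data n S C" "i \<in> {1..n}"
  obtains s where "s \<in> S" "i \<in> s"
  using assms unfolding lifted_code_data_def by (metis Union_iff)

text \<open>Both sides bound the number of pairs \<open>(i, s)\<close> with
  \<open>i \<in> s\<close>, counted by coordinates and by sets. This compares distances normalized
  by \<open>n\<close> with those normalized by \<open>card S\<close>.\<close>

lemma incidence_count:
  assumes "lifted_code_data n S C"
  shows "n * D_min n S \<le> card S * k_max S"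
proof -
  note fin = finite_lifted_code_data[OF assms]
  have "n * D_min n S = (\<Sum>i\<in>{1..n}. D_min n S)" by simp
  also have "\<dots> \<le> (\<Sum>i\<in>{1..n}. card {s\<in>S. i \<in> s})"
    by (rule sum_mono) (auto simp: D_min_def)
  also have "\<dots> = (\<Sum>s\<in>S. card {i\<in>{1..n}. i \<in> s})"
    using fin(1) by (intro sum_multicount_gen) auto
  also have "\<dots> = (\<Sum>s\<in>S. card s)"
  proof (rule sum.cong)
    show "card {i\<in>{1..n}. i \<in> s} = card s" if "s \<in> S" for s
      using fin(2)[OF that] by (intro arg_cong[where f = card]) auto
  qed simp
  also have "\<dots> \<le> (\<Sum>s\<in>S. k_max S)"
    using fin(1) by (intro sum_mono) (auto simp: k_max_def)
  finally show ?thesis by simp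
qed

text \<open>Holds because the sets cover all coordinates. The positivity of \<open>card S\<close>,
  \<open>k_max S\<close> and \<open>D_max n S\<close> in the distance estimate is derived from
  it.\<close>

lemma D_min_pos:
  assumes "lifted_code_data n S C"
  shows "0 < D_min n S"
proof -
  have "D_min n S \<in> (\<lambda>i. card {s\<in>S. i \<in> s}) ` {1..n}"
    unfolding D_min_def using assms by (intro Min_in) (auto simp: lifted_code_data_def)
  then obtain i where i: "i \<in> {1..n}" "D_min n S = card {s\<in>S. i \<in> s}" by auto
  obtain s where "s \<in> S" "i \<in> s" by (rule lifted_code_data_cover[OF assms i(1)])
  with finite_lifted_code_data(1)[OF assms] show ?thesis
    unfolding i(2) by (auto simp: card_gt_0_iff)
qed

text \<open>If \<open>f\<close> and \<open>g\<close> agree on \<open>s\<close>, then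
  \<open>restrict f s\<close> is a codeword and so equals \<open>h s\<close>. Hence every wrong
  entry of \<open>h\<close> is charged to a wrong coordinate of \<open>f\<close> in
  \<open>s\<close>, and a coordinate is charged at most \<open>D_max n S\<close> times, whatever
  \<open>h\<close> does elsewhere.\<close>

lemma hdist_line_word_less:
  assumes data: "lifted_code_data n S C"
    and g: "g \<in> lifted_code n S C"
    and h: "\<And>s. s \<in> S \<Longrightarrow> restrict f s \<in> C s \<Longrightarrow> h s = restrict f s"
    and close: "hdist {1..n} f g < real (D_min n S) / (real (D_max n S) * real (k_max S)) * \<eta>"
  shows "hdist S h (\<lambda>s\<in>S. restrict g s) < \<eta>"
proof -
  note fin = finite_lifted_code_data[OF data]
  define B where "B = {i\<in>{1..n}. f i \<noteq> g i}"
  have n: "n \<ge> 1" using data by (simp add: lifted_code_data_def)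
  have Dmin: "0 < D_min n S" by (rule D_min_pos[OF data])
  have count: "n * D_min n S \<le> card S * k_max S" by (rule incidence_count[OF data])
  moreover have "0 < n * D_min n S" using n Dmin by simp
  ultimately have "0 < card S * k_max S" by linarith
  then have pos: "0 < card S" "0 < k_max S" by simp_all
  have "D_min n S \<le> card {s\<in>S. 1 \<in> s}" "card {s\<in>S. 1 \<in> s} \<le> D_max n S"
    using n by (auto simp: D_min_def D_max_def)
  with Dmin have Dmax: "0 < D_max n S" by linarith
  have "{s\<in>S. h s \<noteq> (\<lambda>s\<in>S. restrict g s) s} \<subseteq> (\<Union>i\<in>B. {s\<in>S. i \<in> s})"
  proof safe
    fix s assume s: "s \<in> S" "h s \<noteq> (\<lambda>s\<in>S. restrict g s) s"
    then have "restrict f s \<noteq> restrict g s"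
      using h[of s] g by (auto simp: lifted_code_def)
    then obtain i where "i \<in> s" "f i \<noteq> g i" by (metis restrict_ext)
    moreover from this fin(2)[OF s(1)] have "i \<in> {1..n}" by blast
    ultimately show "s \<in> (\<Union>i\<in>B. {s\<in>S. i \<in> s})" using s by (auto simp: B_def)
  qed
  then have "card {s\<in>S. h s \<noteq> (\<lambda>s\<in>S. restrict g s) s} \<le> card (\<Union>i\<in>B. {s\<in>S. i \<in> s})"
    using fin(1) by (intro card_mono) (auto simp: B_def)
  also have "\<dots> \<le> (\<Sum>i\<in>B. card {s\<in>S. i \<in> s})"
    by (rule card_UN_le) (simp add: B_def)
  also have "\<dots> \<le> (\<Sum>i\<in>B. D_max n S)"
    by (rule sum_mono) (auto simp: B_def D_max_def)
  finally have "card {s\<in>S. h s \<noteq> (\<lambda>s\<in>S. restrict g s) s} \<le> card B * D_max n S" by simp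
  then have "hdist S h (\<lambda>s\<in>S. restrict g s) \<le> real (card B * D_max n S) / real (card S)"
    unfolding hdist_def by (intro divide_right_mono of_nat_mono) auto
  also have "\<dots> < \<eta>"
  proof -
    have B: "real (card B) * (real (D_max n S) * real (k_max S)) < real (n * D_min n S) * \<eta>"
      using close n Dmax pos by (simp add: hdist_def B_def field_simps)
    \<comment> \<open>A nonnegative quantity lies strictly below the right-hand side, so
      \<open>\<eta>\<close> is positive and the incidence count may be multiplied by it.\<close>
    then have "0 < real (n * D_min n S) * \<eta>"
      by (rule le_less_trans[rotated]) simp
    then have "0 < \<eta>"
      by (rule zero_less_mult_pos) (use n Dmin in simp)
    then have "real (n * D_min n S) * \<eta> \<le> real (card S * k_max S) * \<eta>"
      using count by (intro mult_right_mono of_nat_mono) auto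
    with B have "real (card B * D_max n S) * real (k_max S) < (real (card S) * \<eta>) * real (k_max S)"
      by (simp add: algebra_simps)
    then have "real (card B * D_max n S) < real (card S) * \<eta>"
      by (rule mult_right_less_imp_less) simp
    then show ?thesis using pos by (simp add: field_simps)
  qed
  finally show ?thesis .
qed

lemma line_word_in_line_code:
  assumes "g \<in> lifted_code n S C"
  shows "(\<lambda>s\<in>S. restrict g s) \<in> line_code S C"
  using assms by (auto simp: lifted_code_def line_code_def Int_commute)

text \<open>Every coordinate lies in some member of \<open>S\<close> and can be read off from that
  entry. Uniqueness of the decoded word passes from the line code to the lifted code this
  way.\<close>

lemma line_word_inject:
  assumes "lifted_code_data n S C" "g \<in> lifted_code n S C" "g' \<in> lifted_code n S C"
    and eq: "(\<lambda>s\<in>S. restrict g s) = (\<lambda>s\<in>S. restrict g' s)"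
  shows "g = g'"
proof (rule extensionalityI[of _ "{1..n}"])
  show "g \<in> extensional {1..n}" "g' \<in> extensional {1..n}"
    using assms by (auto simp: lifted_code_def PiE_def)
  fix i assume "i \<in> {1..n}"
  with assms(1) obtain s where "s \<in> S" "i \<in> s" by (rule lifted_code_data_cover)
  then show "g i = g' i" using fun_cong[OF fun_cong[OF eq, of s], of i] by simp
qed

text \<open>A strict bound on the infimum is inherited by one of the distances over which it is
  taken.\<close>

lemma close_to_codeE:
  assumes "close_to_code \<eta> I D f"
  obtains g where "g \<in> D" "hdist I f g < \<eta>"
  using assms by (auto simp: close_to_code_def dist_to_code_def Inf_less_iff)

lemma close_to_codeI:
  assumes "g \<in> D" "hdist I f g < \<eta>"
  shows "close_to_code \<eta> I D f"
  using assms by (force simp: close_to_code_def dist_to_code_def Inf_less_iff)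

section \<open>Total-correctness rules that carry running times\<close>

section \<open>Programs with time bounds\<close>

text \<open>A total-correctness triple with an upper bound on time, since exact step counts depend
  on the data. As \<open>exec\<close> is deterministic, the existing run is the only one.\<close>

definition runs :: "listing \<Rightarrow> program \<Rightarrow> memory \<Rightarrow> nat \<Rightarrow> (memory \<Rightarrow> bool) \<Rightarrow> bool" where
  "runs R P M t Q \<longleftrightarrow> (\<exists>u\<le>t. \<exists>M'. exec R P M u M' \<and> Q M')"

lemma runs_mono:
  assumes "runs R P M t Q" "t \<le> t'" "\<And>M'. Q M' \<Longrightarrow> Q' M'"
  shows "runs R P M t' Q'"
  using assms unfolding runs_def by (meson le_trans)

lemma runs_Store:
  assumes "cost e + cost e' + 1 \<le> t" "Q (M(b := (M b)(val R M e := val R M e')))"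
  shows "runs R (Store b e e') M t Q"
  using assms exec.Store unfolding runs_def by blast

lemma runs_Seq:
  assumes "runs R P M t Q" "\<And>M'. Q M' \<Longrightarrow> runs R P' M' t' Q'" "t + t' \<le> u"
  shows "runs R (Seq P P') M u Q'"
proof -
  from assms(1) obtain v M' where 1: "v \<le> t" "exec R P M v M'" "Q M'"
    by (auto simp: runs_def)
  from assms(2)[OF 1(3)] obtain v' M'' where 2: "v' \<le> t'" "exec R P' M' v' M''" "Q' M''"
    by (auto simp: runs_def)
  from 1 2 assms(3) exec.Seq[OF 1(2) 2(2)] show ?thesis
    unfolding runs_def by (intro exI[of _ "v + v'"]) auto
qed

lemma runs_Cond:
  assumes "val R M e \<noteq> 0 \<Longrightarrow> runs R P M t Q" "val R M e = 0 \<Longrightarrow> runs R P' M t Q"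
    and "cost e + 1 + t \<le> u"
  shows "runs R (Cond e P P') M u Q"
proof (cases "val R M e = 0")
  case True
  with assms(2) obtain v M' where "v \<le> t" "exec R P' M v M'" "Q M'"
    by (auto simp: runs_def)
  with True assms(3) exec.CondFalse[of R M e P' v M' P] show ?thesis
    unfolding runs_def by (intro exI[of _ "cost e + 1 + v"]) auto
next
  case False
  with assms(1) obtain v M' where "v \<le> t" "exec R P M v M'" "Q M'"
    by (auto simp: runs_def)
  with False assms(3) exec.CondTrue[of R M e P v M' P'] show ?thesis
    unfolding runs_def by (intro exI[of _ "cost e + 1 + v"]) auto
qed

text \<open>The counter lives in cell \<open>a\<close> of bank \<open>3\<close>, the bank of scratch variables.\<close>

definition for_loop :: "nat \<Rightarrow> expr \<Rightarrow> program \<Rightarrow> program" where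
  "for_loop a e P = Seq (Store 3 (Const a) (Const 0))
     (While (Minus e (Cell 3 (Const a)))
        (Seq P (Store 3 (Const a) (Plus (Cell 3 (Const a)) (Const 1)))))"

text \<open>A round consists of a test (\<open>cost e + 4\<close> steps), the body and the increment
  (6 steps). The initialization (3 steps) and the last test are absorbed by one more round and the
  constant 13. Since \<open>e\<close> is evaluated anew in each test, \<open>bound\<close> makes the
  invariant fix its value.\<close>

lemma runs_for_loop:
  assumes init: "Inv 0 (M(3 := (M 3)(a := 0)))"
    and bound: "\<And>k M. Inv k M \<Longrightarrow> M 3 a = k \<Longrightarrow> val R M e = N"
    and step: "\<And>k M. k < N \<Longrightarrow> Inv k M \<Longrightarrow> M 3 a = k \<Longrightarrow>
      runs R P M t (\<lambda>M'. M' 3 a = k \<and> Inv (Suc k) (M'(3 := (M' 3)(a := Suc k))))"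
    and time: "(N + 1) * (t + cost e + 13) \<le> u"
    and final: "\<And>M. Inv N M \<Longrightarrow> Q M"
  shows "runs R (for_loop a e P) M u Q"
proof -
  let ?W = "While (Minus e (Cell 3 (Const a)))
    (Seq P (Store 3 (Const a) (Plus (Cell 3 (Const a)) (Const 1))))"
  have loop: "runs R ?W M (cost e + 4 + (N - k) * (t + cost e + 10)) (Inv N)"
    if "k \<le> N" "Inv k M" "M 3 a = k" for k M
    using that
  \<comment> \<open>Downward induction from \<open>k = N\<close>: the time bound is governed by the
    \<open>N - k\<close> remaining rounds. The truncated difference in the test vanishes once the
    counter reaches \<open>N\<close>.\<close>
  proof (induction k arbitrary: M rule: inc_induct)
    case base
    then have "val R M (Minus e (Cell 3 (Const a))) = 0" using bound by simp
    from exec.WhileFalse[OF this] have "exec R ?W M (cost e + 4) M"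
      by (simp add: numeral_eq_Suc)
    with base show ?case unfolding runs_def by auto
  next
    case (step k)
    from assms(3)[OF \<open>k < N\<close> \<open>Inv k M\<close> \<open>M 3 a = k\<close>] obtain v M' where
      1: "v \<le> t" "exec R P M v M'" "M' 3 a = k" "Inv (Suc k) (M'(3 := (M' 3)(a := Suc k)))"
      by (auto simp: runs_def)
    let ?M = "M'(3 := (M' 3)(a := Suc k))"
    have 2: "exec R (Store 3 (Const a) (Plus (Cell 3 (Const a)) (Const 1))) M' 6 ?M"
      using exec.Store[of R 3 "Const a" "Plus (Cell 3 (Const a)) (Const 1)" M'] 1(3)
      by (simp add: numeral_eq_Suc)
    have "runs R ?W ?M (cost e + 4 + (N - Suc k) * (t + cost e + 10)) (Inv N)"
      by (rule step.IH[OF 1(4)]) simp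
    then obtain w M'' where
      3: "w \<le> cost e + 4 + (N - Suc k) * (t + cost e + 10)" "exec R ?W ?M w M''" "Inv N M''"
      unfolding runs_def by blast
    have "val R M (Minus e (Cell 3 (Const a))) \<noteq> 0"
      using bound[OF \<open>Inv k M\<close> \<open>M 3 a = k\<close>] \<open>M 3 a = k\<close> \<open>k < N\<close> by simp
    from exec.WhileTrue[OF this exec.Seq[OF 1(2) 2] 3(2)]
    moreover have "cost (Minus e (Cell 3 (Const a))) + 1 + (v + 6) + w = cost e + 4 + (v + 6) + w"
      by simp
    ultimately have "exec R ?W M (cost e + 4 + (v + 6) + w) M''" by metis
    moreover have "N - k = Suc (N - Suc k)" using \<open>k < N\<close> by simp
    then have "cost e + 4 + (v + 6) + w \<le> cost e + 4 + (N - k) * (t + cost e + 10)"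
      using 1(1) 3(1) by simp
    ultimately show ?case using 3(3) unfolding runs_def by blast
  qed
  have "runs R (for_loop a e P) M (3 + (cost e + 4 + N * (t + cost e + 10))) (Inv N)"
    unfolding for_loop_def
    by (rule runs_Seq[where t = 3 and t' = "cost e + 4 + N * (t + cost e + 10)" and Q = "\<lambda>M'. M' = M(3 := (M 3)(a := 0))"])
       (use loop[of 0] init in \<open>auto intro!: runs_Store\<close>)
  moreover have "3 + (cost e + 4 + N * (t + cost e + 10)) \<le> u"
    using time by (simp add: algebra_simps)
  ultimately show ?thesis using final by (rule runs_mono)
qed

section \<open>Exhaustive search in each code, and restoration of an initial memory\<close>

section \<open>Computing the input of the line decoder\<close>

text \<open>Here \<open>x\<close> is the content of bank 0. Coordinates start at 1 and cells at 0,
  whence the shift. A variable number \<open>m\<close> of compared positions makes this a loop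
  invariant.\<close>

definition matches :: "listing \<Rightarrow> (nat \<Rightarrow> nat) \<Rightarrow> nat \<Rightarrow> nat \<Rightarrow> nat \<Rightarrow> bool" where
  "matches R x j c m \<longleftrightarrow> (\<forall>p<m. letter R j c p = x (element R j p - 1))"

text \<open>The last matching index, as left by a search that overwrites its result at each match.
  The default 0 selects the arbitrary codeword used when the restriction of the received word is not
  in the code.\<close>

primrec pick :: "listing \<Rightarrow> (nat \<Rightarrow> nat) \<Rightarrow> nat \<Rightarrow> nat \<Rightarrow> nat" where
  "pick R x j 0 = 0"
| "pick R x j (Suc c) = (if matches R x j c (set_size R j) then c else pick R x j c)"

lemma pick_less: "0 < m \<Longrightarrow> pick R x j m < m"
proof (induction m)
  case (Suc m)
  then show ?case by (cases m) (auto simp: less_Suc_eq)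
qed simp

lemma matches_pick:
  "c < m \<Longrightarrow> matches R x j c (set_size R j) \<Longrightarrow> matches R x j (pick R x j m) (set_size R j)"
  by (induction m) (auto simp: less_Suc_eq)

text \<open>The input phase uses only the input bank 0, a buffer in bank 2 and scratch cells in bank
  3. Fixing this shape records that all other banks, including the output bank 1, stay zero.\<close>

definition mem :: "(nat \<Rightarrow> nat) \<Rightarrow> (nat \<Rightarrow> nat) \<Rightarrow> (nat \<Rightarrow> nat) \<Rightarrow> memory" where
  "mem x y z = (\<lambda>_ _. 0)(0 := x, 2 := y, 3 := z)"

lemma mem_simps [simp]:
  "mem x y z 0 = x" "mem x y z 2 = y" "mem x y z 3 = z"
  "(mem x y z)(0 := x') = mem x' y z"
  "(mem x y z)(2 := y') = mem x y' z"
  "(mem x y z)(3 := z') = mem x y z'"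
  by (auto simp: mem_def fun_eq_iff)

text \<open>Scratch cells 0, 1, 2 hold the indices of set, word and position. The sum of both
  truncated differences is the absolute difference of the letters, so cell 3 stays 0 exactly as long
  as all letters agree.\<close>

definition test_letter :: program where
  "test_letter =
    (let l = Letter (Cell 3 (Const 0)) (Cell 3 (Const 1)) (Cell 3 (Const 2));
         x = Cell 0 (Minus (Element (Cell 3 (Const 0)) (Cell 3 (Const 2))) (Const 1))
     in Store 3 (Const 3) (Plus (Cell 3 (Const 3)) (Plus (Minus l x) (Minus x l))))"

text \<open>The first branch is the case of a mismatch. The language has no skip instruction, so a
  harmless store stands in for it.\<close>

definition test_word :: program where
  "test_word = Seq (Store 3 (Const 3) (Const 0))
     (Seq (for_loop 2 (SetSize (Cell 3 (Const 0))) test_letter)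
       (Cond (Cell 3 (Const 3)) (Store 3 (Const 3) (Const 0))
         (Store 2 (Cell 3 (Const 0)) (Cell 3 (Const 1)))))"

definition wipe_input :: program where
  "wipe_input = for_loop 0 WordLength (Store 0 (Cell 3 (Const 0)) (Const 0))"

text \<open>The indices wait in bank 2 because bank 0 is read until the last set has been searched.
  The buffer is cleared along with the move, as the line decoder expects zeros there.\<close>

definition move_buffer :: program where
  "move_buffer = for_loop 0 NumSets
     (Seq (Store 0 (Cell 3 (Const 0)) (Cell 2 (Cell 3 (Const 0))))
       (Store 2 (Cell 3 (Const 0)) (Const 0)))"

definition wipe_scratch :: program where
  "wipe_scratch = Seq (Store 3 (Const 0) (Const 0)) (Seq (Store 3 (Const 1) (Const 0))
     (Seq (Store 3 (Const 2) (Const 0)) (Store 3 (Const 3) (Const 0))))"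

definition find_words :: program where
  "find_words = for_loop 0 NumSets (for_loop 1 (NumWords (Cell 3 (Const 0))) test_word)"

definition line_input :: program where
  "line_input = Seq find_words (Seq wipe_input (Seq move_buffer wipe_scratch))"

text \<open>The scratch bank is described only as far as later steps rely on it: the two outer loop
  counters survive, and cells from 4 on remain 0 for the final wipe.\<close>

lemma runs_test_word:
  assumes z: "z 0 = j" "z 1 = c" "\<forall>a\<ge>4. z a = 0" and k: "set_size R j \<le> k"
  shows "runs R test_word (mem x y z) ((k + 1) * 70)
    (\<lambda>M. \<exists>z. M = mem x (if matches R x j c (set_size R j) then y(j := c) else y) z \<and>
       z 0 = j \<and> z 1 = c \<and> (\<forall>a\<ge>4. z a = 0))"
proof -
  let ?Q = "\<lambda>m M. \<exists>z. M = mem x y z \<and> z 0 = j \<and> z 1 = c \<and> (\<forall>a\<ge>4. z a = 0) \<and>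
    (z 3 = 0 \<longleftrightarrow> matches R x j c m)"
  have letters: "runs R (for_loop 2 (SetSize (Cell 3 (Const 0))) test_letter) (mem x y z')
      ((k + 1) * 54) (?Q (set_size R j))"
    if "z' 0 = j" "z' 1 = c" "\<forall>a\<ge>4. z' a = 0" "z' 3 = 0" for z'
  \<comment> \<open>38 is the exact cost of \<open>test_letter\<close>; with the cost 3 of the loop
    bound and the overhead 13 this gives 54 per round.\<close>
  proof (rule runs_for_loop[where Inv = ?Q and N = "set_size R j" and t = 38])
    show "?Q 0 ((mem x y z')(3 := (mem x y z' 3)(2 := 0)))"
      using that by (auto simp: matches_def intro!: exI[of _ "z'(2 := 0)"])
    show "val R M (SetSize (Cell 3 (Const 0))) = set_size R j" if "?Q p M" for p M
      using that by auto
    show "(set_size R j + 1) * (38 + cost (SetSize (Cell 3 (Const 0))) + 13) \<le> (k + 1) * 54"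
      using k by simp
    show "runs R test_letter M 38 (\<lambda>M'. M' 3 2 = p \<and> ?Q (Suc p) (M'(3 := (M' 3)(2 := Suc p))))"
      if p: "p < set_size R j" "?Q p M" "M 3 2 = p" for p M
    proof -
      from p(2) obtain z where M: "M = mem x y z" "z 0 = j" "z 1 = c" "\<forall>a\<ge>4. z a = 0"
        "z 3 = 0 \<longleftrightarrow> matches R x j c p" by (elim exE conjE) (rule that)
      have m: "matches R x j c (Suc p) \<longleftrightarrow>
          matches R x j c p \<and> letter R j c p = x (element R j p - 1)"
        by (auto simp: matches_def less_Suc_eq)
      have z2: "z 2 = p" using M(1) p(3) by simp
      have eq: "e + (a - b + (b - a)) = 0 \<longleftrightarrow> e = 0 \<and> a = b" for a b e :: nat
        by linarith
      define d where "d = letter R j c p - x (element R j p - 1) +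
        (x (element R j p - 1) - letter R j c p)"
      have z3: "z 3 + d = 0 \<longleftrightarrow> matches R x j c (Suc p)"
        unfolding d_def eq M(5) m ..
      have "?Q (Suc p) (mem x y (z(3 := z 3 + d, 2 := Suc p)))"
        using M(2-4) z3 by (intro exI[of _ "z(3 := z 3 + d, 2 := Suc p)"]) simp
      then show ?thesis
        unfolding M(1) test_letter_def Let_def
        by (intro runs_Store) (simp_all add: M(2,3)[simplified] z2 d_def del: ex_simps)
    qed
  qed
  show ?thesis
    unfolding test_word_def
  proof (rule runs_Seq[where t = 3 and t' = "(k + 1) * 54 + 9" and
        Q = "\<lambda>M. M = mem x y (z(3 := 0))"])
    show "runs R (Store 3 (Const 3) (Const 0)) (mem x y z) 3 (\<lambda>M. M = mem x y (z(3 := 0)))"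
      by (rule runs_Store) auto
    show "runs R (Seq (for_loop 2 (SetSize (Cell 3 (Const 0))) test_letter)
       (Cond (Cell 3 (Const 3)) (Store 3 (Const 3) (Const 0))
         (Store 2 (Cell 3 (Const 0)) (Cell 3 (Const 1))))) M ((k + 1) * 54 + 9)
      (\<lambda>M. \<exists>z. M = mem x (if matches R x j c (set_size R j) then y(j := c) else y) z \<and>
       z 0 = j \<and> z 1 = c \<and> (\<forall>a\<ge>4. z a = 0))" if M: "M = mem x y (z(3 := 0))" for M
      unfolding M
    proof (rule runs_Seq[OF letters])
      fix M assume "?Q (set_size R j) M"
      then obtain z where M: "M = mem x y z" "z 0 = j" "z 1 = c" "\<forall>a\<ge>4. z a = 0"
        "z 3 = 0 \<longleftrightarrow> matches R x j c (set_size R j)" by (elim exE conjE) (rule that)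
      let ?R = "\<lambda>M. \<exists>z. M = mem x (if matches R x j c (set_size R j) then y(j := c) else y) z \<and>
       z 0 = j \<and> z 1 = c \<and> (\<forall>a\<ge>4. z a = 0)"
      show "runs R (Cond (Cell 3 (Const 3)) (Store 3 (Const 3) (Const 0))
         (Store 2 (Cell 3 (Const 0)) (Cell 3 (Const 1)))) M 9 ?R"
        unfolding M(1)
      proof (rule runs_Cond[where t = 5])
        assume "val R (mem x y z) (Cell 3 (Const 3)) \<noteq> 0"
        with M(2-5) show "runs R (Store 3 (Const 3) (Const 0)) (mem x y z) 5 ?R"
          by (intro runs_Store exI[of _ "z(3 := 0)"]) simp_all
      next
        assume "val R (mem x y z) (Cell 3 (Const 3)) = 0"
        with M(2-5) show "runs R (Store 2 (Cell 3 (Const 0)) (Cell 3 (Const 1))) (mem x y z) 5 ?R"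
          by (intro runs_Store exI[of _ z]) simp_all
      qed simp
    qed (use z in auto)
  qed auto
qed

text \<open>After \<open>c\<close> rounds of the inner loop, entry \<open>j\<close> of the buffer is
  \<open>pick R x j c\<close>. The loop overheads 16 and 14 raise the factor 70 to 86 and then to
  100.\<close>

lemma runs_find_words:
  assumes z: "\<forall>a\<ge>4. z a = 0"
    and k: "\<And>j. j < num_sets R \<Longrightarrow> set_size R j \<le> k"
    and W: "\<And>j. j < num_sets R \<Longrightarrow> num_words R j \<le> W"
  shows "runs R find_words (mem x (\<lambda>_. 0) z) ((num_sets R + 1) * ((W + 1) * (k + 1) * 100))
    (\<lambda>M. \<exists>z. M = mem x (\<lambda>j. if j < num_sets R then pick R x j (num_words R j) else 0) z \<and>
       (\<forall>a\<ge>4. z a = 0))"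
proof -
  let ?y = "\<lambda>i j. if j < i then pick R x j (num_words R j) else 0"
  let ?I = "\<lambda>i M. \<exists>z. M = mem x (?y i) z \<and> (\<forall>a\<ge>4. z a = 0)"
  show ?thesis
    unfolding find_words_def
  proof (rule runs_for_loop[where Inv = ?I and N = "num_sets R" and t = "(W + 1) * (k + 1) * 86"])
    show "?I 0 ((mem x (\<lambda>_. 0) z)(3 := (mem x (\<lambda>_. 0) z 3)(0 := 0)))"
      using z by auto
    show "(num_sets R + 1) * ((W + 1) * (k + 1) * 86 + cost NumSets + 13)
        \<le> (num_sets R + 1) * ((W + 1) * (k + 1) * 100)"
      by (intro mult_le_mono2) simp
    fix j M assume j: "j < num_sets R" and I: "?I j M" and Mj: "M 3 0 = j"
    from I obtain z where M: "M = mem x (?y j) z" "\<forall>a\<ge>4. z a = 0" by blast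
    with Mj have z0: "z 0 = j" by simp
    let ?J = "\<lambda>c M. \<exists>z. M = mem x ((?y j)(j := pick R x j c)) z \<and> z 0 = j \<and> (\<forall>a\<ge>4. z a = 0)"
    show "runs R (for_loop 1 (NumWords (Cell 3 (Const 0))) test_word) M ((W + 1) * (k + 1) * 86)
      (\<lambda>M'. M' 3 0 = j \<and> ?I (Suc j) (M'(3 := (M' 3)(0 := Suc j))))"
    proof (rule runs_for_loop[where Inv = ?J and N = "num_words R j" and t = "(k + 1) * 70"])
      \<comment> \<open>The untouched buffer entry 0 is already the default value of
        \<open>pick\<close>.\<close>
      have "(?y j)(j := 0) = ?y j" by auto
      then show "?J 0 (M(3 := (M 3)(1 := 0)))"
        using M z0 by auto
      show "val R M (NumWords (Cell 3 (Const 0))) = num_words R j" if "?J c M" for c M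
        using that by auto
      have "(num_words R j + 1) * ((k + 1) * 70 + 16) \<le> (W + 1) * ((k + 1) * 86)"
        using W[OF j] by (intro mult_le_mono) auto
      then show "(num_words R j + 1) * ((k + 1) * 70 + cost (NumWords (Cell 3 (Const 0))) + 13)
          \<le> (W + 1) * (k + 1) * 86"
        by (simp add: algebra_simps)
      show "runs R test_word M ((k + 1) * 70)
          (\<lambda>M'. M' 3 1 = c \<and> ?J (Suc c) (M'(3 := (M' 3)(1 := Suc c))))"
        if c: "?J c M" "M 3 1 = c" for c M
      proof -
        from c(1) obtain z where z: "M = mem x ((?y j)(j := pick R x j c)) z" "z 0 = j"
          "\<forall>a\<ge>4. z a = 0" by blast
        with c(2) have z1: "z 1 = c" by simp
        show ?thesis
          unfolding z(1)
          by (rule runs_mono[OF runs_test_word[OF z(2) z1 z(3) k[OF j]] order_refl])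
             (auto split: if_splits)
      qed
      have y: "(?y j)(j := pick R x j (num_words R j)) = ?y (Suc j)"
        by (auto simp: less_Suc_eq)
      show "M' 3 0 = j \<and> ?I (Suc j) (M'(3 := (M' 3)(0 := Suc j)))"
        if "?J (num_words R j) M'" for M'
        using that unfolding y by auto
    qed
  qed auto
qed

lemma runs_wipe_input:
  assumes z: "\<forall>a\<ge>4. z a = 0" and x: "\<forall>a\<ge>word_length R. x a = 0"
  shows "runs R wipe_input (mem x y z) ((word_length R + 1) * 20)
    (\<lambda>M. \<exists>z. M = mem (\<lambda>_. 0) y z \<and> (\<forall>a\<ge>4. z a = 0))"
proof -
  let ?I = "\<lambda>i M. \<exists>z. M = mem (\<lambda>a. if a < i then 0 else x a) y z \<and> (\<forall>a\<ge>4. z a = 0)"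
  have last: "(\<lambda>a. if a < word_length R then 0 else x a) = (\<lambda>_. 0)"
    using x by auto
  show ?thesis
    unfolding wipe_input_def
  proof (rule runs_for_loop[where Inv = ?I and N = "word_length R" and t = 4])
    show "?I 0 ((mem x y z)(3 := (mem x y z 3)(0 := 0)))" using z by auto
    fix k M assume I: "?I k M" and Mk: "M 3 0 = k"
    have upd: "(\<lambda>a. if a < k then 0 else x a)(k := 0) = (\<lambda>a. if a < Suc k then 0 else x a)"
      by (auto simp: less_Suc_eq)
    from I obtain z where M: "M = mem (\<lambda>a. if a < k then 0 else x a) y z" "\<forall>a\<ge>4. z a = 0"
      by blast
    with Mk have z0: "z 0 = k" by simp
    show "runs R (Store 0 (Cell 3 (Const 0)) (Const 0)) M 4
        (\<lambda>M'. M' 3 0 = k \<and> ?I (Suc k) (M'(3 := (M' 3)(0 := Suc k))))"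
      unfolding M(1)
      by (rule runs_Store) (use M(2) in \<open>auto simp: z0 upd intro!: exI[of _ "z(0 := Suc k)"]\<close>)
  next
    show "\<exists>z. M = mem (\<lambda>_. 0) y z \<and> (\<forall>a\<ge>4. z a = 0)" if "?I (word_length R) M" for M
      using that unfolding last .
  qed simp_all
qed

lemma runs_move_buffer:
  assumes z: "\<forall>a\<ge>4. z a = 0" and y: "\<forall>a\<ge>num_sets R. y a = 0"
  shows "runs R move_buffer (mem (\<lambda>_. 0) y z) ((num_sets R + 1) * 30)
    (\<lambda>M. \<exists>z. M = mem y (\<lambda>_. 0) z \<and> (\<forall>a\<ge>4. z a = 0))"
proof -
  let ?I = "\<lambda>i M. \<exists>z. M = mem (\<lambda>a. if a < i then y a else 0) (\<lambda>a. if a < i then 0 else y a) z \<and>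
    (\<forall>a\<ge>4. z a = 0)"
  have last: "(\<lambda>a. if a < num_sets R then 0 else y a) = (\<lambda>_. 0)"
    "(\<lambda>a. if a < num_sets R then y a else 0) = y"
    using y by auto
  show ?thesis
    unfolding move_buffer_def
  proof (rule runs_for_loop[where Inv = ?I and N = "num_sets R" and t = 11])
    show "?I 0 ((mem (\<lambda>_. 0) y z)(3 := (mem (\<lambda>_. 0) y z 3)(0 := 0)))" using z by auto
    fix k M assume I: "?I k M" and Mk: "M 3 0 = k"
    from I obtain z where M:
      "M = mem (\<lambda>a. if a < k then y a else 0) (\<lambda>a. if a < k then 0 else y a) z"
      "\<forall>a\<ge>4. z a = 0" by blast
    with Mk have z0: "z 0 = k" by simp
    have upd: "(\<lambda>a. if a < k then 0 else y a)(k := 0) = (\<lambda>a. if a < Suc k then 0 else y a)"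
      "(\<lambda>a. if a < k then y a else 0)(k := y k) = (\<lambda>a. if a < Suc k then y a else 0)"
      by (auto simp: less_Suc_eq)
    show "runs R (Seq (Store 0 (Cell 3 (Const 0)) (Cell 2 (Cell 3 (Const 0))))
       (Store 2 (Cell 3 (Const 0)) (Const 0))) M 11
        (\<lambda>M'. M' 3 0 = k \<and> ?I (Suc k) (M'(3 := (M' 3)(0 := Suc k))))"
    proof (rule runs_Seq[where t' = 4])
      show "runs R (Store 0 (Cell 3 (Const 0)) (Cell 2 (Cell 3 (Const 0)))) M 7
        (\<lambda>M. M = mem (\<lambda>a. if a < Suc k then y a else 0) (\<lambda>a. if a < k then 0 else y a) z)"
        unfolding M(1) by (rule runs_Store) (auto simp: z0 upd)
      show "runs R (Store 2 (Cell 3 (Const 0)) (Const 0)) M 4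
        (\<lambda>M'. M' 3 0 = k \<and> ?I (Suc k) (M'(3 := (M' 3)(0 := Suc k))))"
        if "M = mem (\<lambda>a. if a < Suc k then y a else 0) (\<lambda>a. if a < k then 0 else y a) z" for M
        unfolding that
        by (rule runs_Store) (use M(2) in \<open>auto simp: z0 upd intro!: exI[of _ "z(0 := Suc k)"]\<close>)
    qed simp
  next
    show "\<exists>z. M = mem y (\<lambda>_. 0) z \<and> (\<forall>a\<ge>4. z a = 0)" if "?I (num_sets R) M" for M
      using that unfolding last .
  qed simp_all
qed

lemma runs_wipe_scratch:
  assumes z: "\<forall>a\<ge>4. z a = 0"
  shows "runs R wipe_scratch (mem x y z) 12 (\<lambda>M. M = mem x y (\<lambda>_. 0))"
proof -
  have zero: "z(0 := 0, Suc 0 := 0, 2 := 0, 3 := 0) = (\<lambda>_. 0)"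
  proof
    fix a :: nat
    have "a = 0 \<or> a = 1 \<or> a = 2 \<or> a = 3 \<or> a \<ge> 4" by linarith
    then show "(z(0 := 0, Suc 0 := 0, 2 := 0, 3 := 0)) a = 0" using z by auto
  qed
  show ?thesis
    unfolding wipe_scratch_def
    apply (rule runs_Seq[where t = 3 and t' = 9 and Q = "\<lambda>M. M = mem x y (z(0 := 0))"])
      apply (rule runs_Store; simp)
     apply (rule runs_Seq[where t = 3 and t' = 6 and Q = "\<lambda>M. M = mem x y (z(0 := 0, 1 := 0))"])
       apply (rule runs_Store; simp)
      apply (rule runs_Seq[where t = 3 and t' = 3 and Q = "\<lambda>M. M = mem x y (z(0 := 0, 1 := 0, 2 := 0))"])
        apply (rule runs_Store; simp)
       apply (rule runs_Store; simp add: zero)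
      apply simp_all
    done
qed

text \<open>Turns the extra round of the loop rule into a bound linear in \<open>n + N\<close>,
  using \<open>N + 1 \<le> n + N\<close>.\<close>

lemma mult_Suc_le_add:
  fixes m c n N :: nat
  assumes "1 \<le> n"
  shows "(N + 1) * (m * c) \<le> c * (m * (n + N))"
proof -
  have "(N + 1) * (m * c) \<le> (n + N) * (m * c)"
    using assms by (intro mult_le_mono1) simp
  then show ?thesis by (simp only: mult.commute mult.left_commute)
qed

text \<open>The final memory is determined completely, not just its first cells, because the run of
  the line decoder is only known from its own initial memory.\<close>

lemma runs_line_input:
  assumes xs: "length xs = word_length R" "word_length R \<ge> 1"
    and k: "\<And>j. j < num_sets R \<Longrightarrow> set_size R j \<le> k"
    and W: "\<And>j. j < num_sets R \<Longrightarrow> num_words R j \<le> W"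
  defines "x \<equiv> \<lambda>a. if a < length xs then xs ! a else 0"
  shows "runs R line_input (initial_memory xs)
    (200 * ((W + 1) * (k + 1) * (word_length R + num_sets R)))
    (\<lambda>M. M = initial_memory (map (\<lambda>j. pick R x j (num_words R j)) [0..<num_sets R]))"
proof -
  let ?y = "\<lambda>j. if j < num_sets R then pick R x j (num_words R j) else 0"
  let ?m = "(W + 1) * (k + 1)"
  have start: "initial_memory xs = mem x (\<lambda>_. 0) (\<lambda>_. 0)"
    by (auto simp: initial_memory_def mem_def x_def fun_eq_iff)
  have final: "initial_memory (map (\<lambda>j. pick R x j (num_words R j)) [0..<num_sets R]) =
      mem ?y (\<lambda>_. 0) (\<lambda>_. 0)"
    by (auto simp: initial_memory_def mem_def fun_eq_iff)
  have run: "runs R line_input (initial_memory xs)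
    ((num_sets R + 1) * (?m * 100) + ((word_length R + 1) * 20 + ((num_sets R + 1) * 30 + 12)))
    (\<lambda>M. M = mem ?y (\<lambda>_. 0) (\<lambda>_. 0))"
    unfolding line_input_def start
  proof (rule runs_Seq[OF runs_find_words[OF _ k W] _ order_refl], simp)
    fix M assume "\<exists>z. M = mem x ?y z \<and> (\<forall>a\<ge>4. z a = 0)"
    then obtain z where M: "M = mem x ?y z" and z: "\<forall>a\<ge>4. z a = 0" by blast
    show "runs R (Seq wipe_input (Seq move_buffer wipe_scratch)) M
      ((word_length R + 1) * 20 + ((num_sets R + 1) * 30 + 12)) (\<lambda>M. M = mem ?y (\<lambda>_. 0) (\<lambda>_. 0))"
      unfolding M
    proof (rule runs_Seq[OF runs_wipe_input[OF z] _ order_refl])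
      show "\<forall>a\<ge>word_length R. x a = 0" using xs by (simp add: x_def)
      fix M assume "\<exists>z. M = mem (\<lambda>_. 0) ?y z \<and> (\<forall>a\<ge>4. z a = 0)"
      then obtain z where M: "M = mem (\<lambda>_. 0) ?y z" and z: "\<forall>a\<ge>4. z a = 0" by blast
      show "runs R (Seq move_buffer wipe_scratch) M ((num_sets R + 1) * 30 + 12)
        (\<lambda>M. M = mem ?y (\<lambda>_. 0) (\<lambda>_. 0))"
        unfolding M
        by (rule runs_Seq[OF runs_move_buffer[OF z] _ order_refl])
           (auto intro: runs_wipe_scratch)
    qed
  qed
  have "(num_sets R + 1) * (?m * 100) \<le> 100 * (?m * (word_length R + num_sets R))"
    using xs(2) by (rule mult_Suc_le_add)
  moreover have "(word_length R + 1) * 20 + ((num_sets R + 1) * 30 + 12)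
      \<le> 100 * (word_length R + num_sets R)"
    using xs(2) by simp
  moreover have "100 * (word_length R + num_sets R) \<le> 100 * (?m * (word_length R + num_sets R))"
    by simp
  ultimately have "(num_sets R + 1) * (?m * 100) +
      ((word_length R + 1) * 20 + ((num_sets R + 1) * 30 + 12))
      \<le> 200 * (?m * (word_length R + num_sets R))"
    by linarith
  then show ?thesis
    unfolding final by (rule runs_mono[OF run])
qed

section \<open>Reassembling a codeword from the indices of its restrictions\<close>

section \<open>Reading off the codeword\<close>

text \<open>Letters are collected in bank 2 because bank 1 still holds the indices put out by the
  line decoder. A coordinate is rewritten for each set containing it.\<close>

definition read_sets :: program where
  "read_sets = for_loop 0 NumSets (for_loop 1 (SetSize (Cell 3 (Const 0)))
     (Store 2 (Minus (Element (Cell 3 (Const 0)) (Cell 3 (Const 1))) (Const 1))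
       (Letter (Cell 3 (Const 0)) (Cell 1 (Cell 3 (Const 0))) (Cell 3 (Const 1)))))"

definition copy_output :: program where
  "copy_output = for_loop 0 WordLength
     (Store 1 (Cell 3 (Const 0)) (Cell 2 (Cell 3 (Const 0))))"

definition line_output :: program where
  "line_output = Seq read_sets copy_output"

text \<open>Since all letters destined for one cell are the value of \<open>G\<close> there, a later
  write never spoils an earlier one. Apart from bank 1 the starting memory is arbitrary, as the line
  decoder may leave anything behind.\<close>

lemma runs_read_sets:
  assumes G: "\<And>j p. j < num_sets R \<Longrightarrow> p < set_size R j \<Longrightarrow>
      letter R j (M 1 j) p = G (element R j p - 1)"
    and k: "\<And>j. j < num_sets R \<Longrightarrow> set_size R j \<le> k"
  shows "runs R read_sets M ((num_sets R + 1) * ((k + 1) * 50))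
    (\<lambda>M'. \<forall>j<num_sets R. \<forall>p<set_size R j. M' 2 (element R j p - 1) = G (element R j p - 1))"
proof -
  let ?I = "\<lambda>i M'. M' 1 = M 1 \<and>
    (\<forall>j<i. \<forall>p<set_size R j. M' 2 (element R j p - 1) = G (element R j p - 1))"
  show ?thesis
    unfolding read_sets_def
  proof (rule runs_for_loop[where Inv = ?I and N = "num_sets R" and t = "(k + 1) * 32"])
    show "(num_sets R + 1) * ((k + 1) * 32 + cost NumSets + 13)
        \<le> (num_sets R + 1) * ((k + 1) * 50)"
      by (intro mult_le_mono2) simp
    fix j and M' :: memory assume j: "j < num_sets R" and I: "?I j M'" and Mj: "M' 3 0 = j"
    let ?J = "\<lambda>m M'. ?I j M' \<and> M' 3 0 = j \<and>
      (\<forall>p<m. M' 2 (element R j p - 1) = G (element R j p - 1))"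
    show "runs R (for_loop 1 (SetSize (Cell 3 (Const 0)))
       (Store 2 (Minus (Element (Cell 3 (Const 0)) (Cell 3 (Const 1))) (Const 1))
         (Letter (Cell 3 (Const 0)) (Cell 1 (Cell 3 (Const 0))) (Cell 3 (Const 1))))) M' ((k + 1) * 32)
      (\<lambda>M'. M' 3 0 = j \<and> ?I (Suc j) (M'(3 := (M' 3)(0 := Suc j))))"
    proof (rule runs_for_loop[where Inv = ?J and N = "set_size R j" and t = 16])
      show "?J 0 (M'(3 := (M' 3)(1 := 0)))" using I Mj by auto
      show "(set_size R j + 1) * (16 + cost (SetSize (Cell 3 (Const 0))) + 13) \<le> (k + 1) * 32"
        using k[OF j] by simp
      show "M' 3 0 = j \<and> ?I (Suc j) (M'(3 := (M' 3)(0 := Suc j)))"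
        if "?J (set_size R j) M'" for M' :: memory
        using that by (auto simp: less_Suc_eq)
      fix p and M' :: memory assume p: "p < set_size R j" and J: "?J p M'" and Mp: "M' 3 1 = p"
      then show "runs R (Store 2 (Minus (Element (Cell 3 (Const 0)) (Cell 3 (Const 1))) (Const 1))
         (Letter (Cell 3 (Const 0)) (Cell 1 (Cell 3 (Const 0))) (Cell 3 (Const 1)))) M' 16
         (\<lambda>M'. M' 3 1 = p \<and> ?J (Suc p) (M'(3 := (M' 3)(1 := Suc p))))"
        using G[OF j p] by (intro runs_Store) (auto simp: less_Suc_eq)
    qed auto
  qed auto
qed

lemma runs_copy_output:
  assumes "\<And>a. a < word_length R \<Longrightarrow> M 2 a = G a"
  shows "runs R copy_output M ((word_length R + 1) * 21) (\<lambda>M. \<forall>a<word_length R. M 1 a = G a)"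
proof -
  let ?I = "\<lambda>i M'. M' 2 = M 2 \<and> (\<forall>a<i. M' 1 a = M 2 a)"
  show ?thesis
    unfolding copy_output_def
    by (rule runs_for_loop[where Inv = ?I and N = "word_length R" and t = 7])
       (auto intro!: runs_Store simp: less_Suc_eq assms)
qed

lemma runs_line_output:
  assumes "word_length R \<ge> 1"
    and G: "\<And>j p. j < num_sets R \<Longrightarrow> p < set_size R j \<Longrightarrow>
      letter R j (M 1 j) p = G (element R j p - 1)"
    and k: "\<And>j. j < num_sets R \<Longrightarrow> set_size R j \<le> k"
    and cover: "\<And>a. a < word_length R \<Longrightarrow>
      \<exists>j<num_sets R. \<exists>p<set_size R j. element R j p - 1 = a"
  shows "runs R line_output M (100 * ((k + 1) * (word_length R + num_sets R)))
    (\<lambda>M. \<forall>a<word_length R. M 1 a = G a)"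
  unfolding line_output_def
proof (rule runs_Seq[OF runs_read_sets[of R M G k, OF G k]])
  show "runs R copy_output M' ((word_length R + 1) * 21) (\<lambda>M. \<forall>a<word_length R. M 1 a = G a)"
    if "\<forall>j<num_sets R. \<forall>p<set_size R j. M' 2 (element R j p - 1) = G (element R j p - 1)" for M'
    using that cover by (intro runs_copy_output) metis
  have "(num_sets R + 1) * ((k + 1) * 50) \<le> 50 * ((k + 1) * (word_length R + num_sets R))"
    using assms(1) by (rule mult_Suc_le_add)
  moreover have "(word_length R + 1) * 21 \<le> 50 * (word_length R + num_sets R)"
    using assms(1) by simp
  moreover have "50 * (word_length R + num_sets R) \<le> 50 * ((k + 1) * (word_length R + num_sets R))"
    by simp
  ultimately show "(num_sets R + 1) * ((k + 1) * 50) + (word_length R + 1) * 21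
      \<le> 100 * ((k + 1) * (word_length R + num_sets R))"
    by linarith
qed

section \<open>Correctness of the composite decoder and the linear time bound\<close>

section \<open>The decoder\<close>

lemma position_nth:
  assumes "distinct xs" "j < length xs"
  shows "position xs (xs ! j) = j"
  unfolding position_def using assms by (intro the_equality) (auto simp: nth_eq_iff_index_eq)

lemma nth_position:
  assumes "distinct xs" "x \<in> set xs"
  shows "position xs x < length xs" "xs ! position xs x = x"
  using assms by (auto simp: in_set_conv_nth position_nth)

text \<open>The case of a single code, with the dependence on set sizes and code sizes explicit. The
  composite program depends on \<open>P\<close> alone, so it can serve a whole family.\<close>

lemma decodes_lifted_code:
  fixes C :: "nat set \<Rightarrow> (nat \<Rightarrow> 'a::finite) set" and aux :: "nat \<Rightarrow> nat"
  assumes data: "lifted_code_data n S C"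
    and \<alpha>: "inj \<alpha>"
    and enum: "enumerates ss cs S C"
    and k: "\<And>s. s \<in> S \<Longrightarrow> card s \<le> k"
    and W: "\<And>s. s \<in> S \<Longrightarrow> card (C s) \<le> W"
  defines "R \<equiv> listing_of \<alpha> n ss cs aux"
  assumes dec: "decodes_within R P S (PiE S C) (line_code S C) (enc_line_word ss cs) \<eta> T"
  shows "decodes_within R (Seq line_input (Seq P line_output)) {1..n} ({1..n} \<rightarrow>\<^sub>E UNIV)
    (lifted_code n S C) (enc_word \<alpha> n)
    (real (D_min n S) / (real (D_max n S) * real (k_max S)) * \<eta>)
    (T + 300 * ((W + 1) * (k + 1)) * (n + card S))"
  unfolding decodes_within_def
proof (intro ballI impI)
  let ?\<gamma> = "real (D_min n S) / (real (D_max n S) * real (k_max S)) * \<eta>"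
  note fin = finite_lifted_code_data[OF data]
  have ss: "distinct ss" "set ss = S" and cs: "\<And>s. s \<in> S \<Longrightarrow> distinct (cs s) \<and> set (cs s) = C s"
    using enum by (auto simp: enumerates_def)
  have len: "length ss = card S" using ss distinct_card by fastforce
  have lcs: "length (cs s) = card (C s)" if "s \<in> S" for s
    using cs[OF that] distinct_card by fastforce
  have ssj: "ss ! j \<in> S" if "j < card S" for j using that ss len by (metis nth_mem)
  have n: "n \<ge> 1" using data by (simp add: lifted_code_data_def)
  have R: "word_length R = n" "num_sets R = card S"
    "\<And>j. j < card S \<Longrightarrow> set_size R j = card (ss ! j)"
    "\<And>j. j < card S \<Longrightarrow> num_words R j = length (cs (ss ! j))"
    "\<And>j p. j < card S \<Longrightarrow> p < card (ss ! j) \<Longrightarrow> element R j p = sorted_list_of_set (ss ! j) ! p"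
    "\<And>j c p. j < card S \<Longrightarrow> c < length (cs (ss ! j)) \<Longrightarrow> p < card (ss ! j) \<Longrightarrow>
       letter R j c p = \<alpha> ((cs (ss ! j) ! c) (sorted_list_of_set (ss ! j) ! p))"
    by (auto simp: R_def listing_of_def len)
  have elem: "sorted_list_of_set (ss ! j) ! p \<in> ss ! j" if "j < card S" "p < card (ss ! j)" for j p
    using fin(2)[OF ssj[OF that(1)]] that(2)
    by (metis nth_mem set_sorted_list_of_set length_sorted_list_of_set)
  have elem': "\<exists>p<card (ss ! j). sorted_list_of_set (ss ! j) ! p = i" if "j < card S" "i \<in> ss ! j" for i j
    using fin(2)[OF ssj[OF that(1)]] that(2)
    by (metis in_set_conv_nth set_sorted_list_of_set length_sorted_list_of_set)
  have Rk: "set_size R j \<le> k" and RW: "num_words R j \<le> W" if "j < num_sets R" for j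
    using that ssj[of j] k W lcs by (auto simp: R)
  fix f :: "nat \<Rightarrow> 'a" assume "f \<in> {1..n} \<rightarrow>\<^sub>E UNIV" and "close_to_code ?\<gamma> {1..n} (lifted_code n S C) f"
  then obtain g where g: "g \<in> lifted_code n S C" and fg: "hdist {1..n} f g < ?\<gamma>"
    by (auto elim: close_to_codeE)
  let ?xs = "enc_word \<alpha> n f"
  define x where "x = (\<lambda>a. if a < length ?xs then ?xs ! a else 0)"
  have lenxs: "length ?xs = word_length R" by (simp add: enc_word_def R)
  have x: "x (i - 1) = \<alpha> (f i)" if "i \<in> {1..n}" for i
    using that by (auto simp: x_def enc_word_def simp del: upt_Suc)
  define c where "c j = pick R x j (num_words R j)" for j
  have c: "c j < length (cs (ss ! j))" if "j < card S" for j
  proof -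
    \<comment> \<open>Nonemptiness makes the default index 0 of \<open>pick\<close> a valid
      one.\<close>
    have "C (ss ! j) \<noteq> {}" using data ssj[OF that] by (simp add: lifted_code_data_def)
    then have "0 < length (cs (ss ! j))" using cs[OF ssj[OF that]] by auto
    then show ?thesis using pick_less[of "num_words R j" R x j] that by (simp add: c_def R)
  qed
  define h where "h = (\<lambda>s\<in>S. cs s ! c (position ss s))"
  have hj: "h (ss ! j) = cs (ss ! j) ! c j" if "j < card S" for j
    using that ssj ss len by (simp add: h_def position_nth)
  have hC: "h \<in> PiE S C"
  proof (rule PiE_I)
    fix s assume "s \<in> S"
    then obtain j where j: "j < card S" "s = ss ! j" using ss len by (metis in_set_conv_nth)
    then show "h s \<in> C s" using c[OF j(1)] hj[OF j(1)] cs[OF ssj[OF j(1)]] nth_mem by force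
  qed (simp add: h_def)
  \<comment> \<open>Letter numbers may be compared because \<open>\<alpha>\<close> is injective, and
    an extensional word is determined by its values on the set.\<close>
  have agree: "cs (ss ! j) ! d = restrict f (ss ! j) \<longleftrightarrow> matches R x j d (set_size R j)"
    if j: "j < card S" and d: "d < length (cs (ss ! j))" for j d
  proof -
    let ?s = "ss ! j" and ?w = "cs (ss ! j) ! d"
    have "?w \<in> C ?s" using cs[OF ssj[OF j]] d nth_mem by blast
    then have ext: "?w \<in> extensional ?s"
      using data ssj[OF j] by (auto simp: lifted_code_data_def PiE_def)
    have "matches R x j d (set_size R j) \<longleftrightarrow>
        (\<forall>p<card ?s. ?w (sorted_list_of_set ?s ! p) = f (sorted_list_of_set ?s ! p))"
    proof -
      have "letter R j d p = x (element R j p - 1) \<longleftrightarrow>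
          ?w (sorted_list_of_set ?s ! p) = f (sorted_list_of_set ?s ! p)" if "p < card ?s" for p
        using j d that x[of "sorted_list_of_set ?s ! p"] elem[OF j that] fin(2)[OF ssj[OF j]]
          inj_eq[OF \<alpha>] by (auto simp: R)
      then show ?thesis using j by (simp add: matches_def R)
    qed
    also have "\<dots> \<longleftrightarrow> (\<forall>i\<in>?s. ?w i = f i)"
      using elem[OF j] elem'[OF j] by metis
    also have "\<dots> \<longleftrightarrow> ?w = restrict f ?s"
      using ext by (auto simp: extensional_def fun_eq_iff)
    finally show ?thesis by simp
  qed
  have hs: "h s = restrict f s" if s: "s \<in> S" "restrict f s \<in> C s" for s
  proof -
    obtain j where j: "j < card S" "s = ss ! j" using s ss len by (metis in_set_conv_nth)
    obtain d where d: "d < length (cs (ss ! j))" "cs (ss ! j) ! d = restrict f (ss ! j)"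
      using cs[OF s(1)] s(2) j by (metis in_set_conv_nth)
    then have "matches R x j (c j) (set_size R j)"
      using agree[OF j(1) d(1)] matches_pick[of d "num_words R j" R x j] j(1) by (simp add: c_def R)
    then show ?thesis using agree[OF j(1) c[OF j(1)]] hj[OF j(1)] j(2) by simp
  qed
  have near: "hdist S h (\<lambda>s\<in>S. restrict g s) < \<eta>"
    if "g \<in> lifted_code n S C" "hdist {1..n} f g < ?\<gamma>" for g
    by (rule hdist_line_word_less[OF data that(1) hs that(2)])
  have "close_to_code \<eta> S (line_code S C) h"
    by (rule close_to_codeI[OF line_word_in_line_code[OF g] near[OF g fg]])
  with dec hC obtain h' u M where h': "h' \<in> line_code S C"
      "\<And>g. g \<in> line_code S C \<Longrightarrow> hdist S h g < \<eta> \<Longrightarrow> g = h'"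
    and u: "u \<le> T" "exec R P (initial_memory (enc_line_word ss cs h)) u M"
      "has_output M (enc_line_word ss cs h')"
    unfolding decodes_within_def by blast
  \<comment> \<open>Every codeword near \<open>f\<close> has a line word near \<open>h\<close>, and
    the line decoder guarantees that only \<open>h'\<close> is that near.\<close>
  have h'eq: "h' = (\<lambda>s\<in>S. restrict g' s)"
    if "g' \<in> lifted_code n S C" "hdist {1..n} f g' < ?\<gamma>" for g'
    using h'(2)[OF line_word_in_line_code near] that by metis
  have unique: "\<forall>g'\<in>lifted_code n S C. hdist {1..n} f g' < ?\<gamma> \<longrightarrow> g' = g"
    using h'eq h'eq[OF g fg] line_word_inject[OF data _ g] by metis
  \<comment> \<open>The lists of codewords are duplicate-free, so the position of the chosen word is
    the index found by the search.\<close>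
  have input: "enc_line_word ss cs h = map c [0..<num_sets R]"
  proof (rule nth_equalityI)
    show "enc_line_word ss cs h ! j = map c [0..<num_sets R] ! j"
      if "j < length (enc_line_word ss cs h)" for j
      using that hj[of j] c[of j] cs[OF ssj[of j]]
      by (auto simp: enc_line_word_def len R position_nth)
  qed (simp add: enc_line_word_def len R)
  have M1: "M 1 j < length (cs (ss ! j)) \<and> cs (ss ! j) ! M 1 j = restrict g (ss ! j)"
    if j: "j < card S" for j
  proof -
    have "M 1 j = position (cs (ss ! j)) (h' (ss ! j))"
      using u(3) j by (simp add: has_output_def enc_line_word_def len)
    also have "h' (ss ! j) = restrict g (ss ! j)"
      using h'eq[OF g fg] ssj[OF j] by simp
    finally have "M 1 j = position (cs (ss ! j)) (restrict g (ss ! j))" .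
    moreover have "restrict g (ss ! j) \<in> set (cs (ss ! j))"
      using g ssj[OF j] cs by (auto simp: lifted_code_def)
    ultimately show ?thesis using nth_position cs[OF ssj[OF j]] by metis
  qed
  have out: "runs R line_output M (100 * ((k + 1) * (word_length R + num_sets R)))
    (\<lambda>M. \<forall>a<word_length R. M 1 a = \<alpha> (g (a + 1)))"
  proof (rule runs_line_output)
    fix j p assume "j < num_sets R" "p < set_size R j"
    then have jp: "j < card S" "p < card (ss ! j)" by (auto simp: R)
    with elem[OF jp] fin(2)[OF ssj[OF jp(1)]] M1[OF jp(1)]
    show "letter R j (M 1 j) p = \<alpha> (g (element R j p - 1 + 1))"
      by (auto simp: R subset_iff)
  next
    fix a assume "a < word_length R"
    then have "a + 1 \<in> {1..n}" by (simp add: R)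
    then obtain s where "s \<in> S" "a + 1 \<in> s"
      by (rule lifted_code_data_cover[OF data])
    moreover from this obtain j where "j < card S" "s = ss ! j" using ss len by (metis in_set_conv_nth)
    ultimately obtain p where "j < card S" "p < card (ss ! j)" "sorted_list_of_set (ss ! j) ! p = a + 1"
      using elem' by blast
    then show "\<exists>j<num_sets R. \<exists>p<set_size R j. element R j p - 1 = a"
      by (intro exI[of _ j] conjI exI[of _ p]) (auto simp: R)
  qed (use n Rk in \<open>auto simp: R\<close>)
  have "runs R (Seq line_input (Seq P line_output)) (initial_memory ?xs)
    (200 * ((W + 1) * (k + 1) * (word_length R + num_sets R)) +
      (T + 100 * ((k + 1) * (word_length R + num_sets R))))
    (\<lambda>M. \<forall>a<word_length R. M 1 a = \<alpha> (g (a + 1)))"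
  proof (rule runs_Seq[OF runs_line_input[OF lenxs _ Rk RW] _ order_refl])
    show "1 \<le> word_length R" using n by (simp add: R)
    fix M' assume "M' = initial_memory (map (\<lambda>j. pick R (\<lambda>a. if a < length ?xs then ?xs ! a else 0)
      j (num_words R j)) [0..<num_sets R])"
    then have M': "M' = initial_memory (enc_line_word ss cs h)"
      by (auto simp: input c_def x_def intro!: arg_cong[where f = initial_memory])
    show "runs R (Seq P line_output) M' (T + 100 * ((k + 1) * (word_length R + num_sets R)))
      (\<lambda>M. \<forall>a<word_length R. M 1 a = \<alpha> (g (a + 1)))"
      unfolding M'
      \<comment> \<open>The intermediate condition pins the memory to the \<open>M\<close> left by
        the line decoder, for which \<open>out\<close> was shown.\<close>
      by (rule runs_Seq[where Q = "\<lambda>M'. M' = M", OF _ _ order_refl])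
         (use u out in \<open>auto simp: runs_def\<close>)
  qed
  moreover have "200 * ((W + 1) * (k + 1) * (word_length R + num_sets R)) +
      (T + 100 * ((k + 1) * (word_length R + num_sets R)))
      \<le> T + 300 * ((W + 1) * (k + 1)) * (n + card S)"
    by (simp add: R algebra_simps)
  ultimately have "runs R (Seq line_input (Seq P line_output)) (initial_memory ?xs)
    (T + 300 * ((W + 1) * (k + 1)) * (n + card S)) (\<lambda>M. has_output M (enc_word \<alpha> n g))"
    by (rule runs_mono) (auto simp: has_output_def enc_word_def R simp del: upt_Suc)
  with g fg unique show "\<exists>g\<in>lifted_code n S C. hdist {1..n} f g < ?\<gamma> \<and>
      (\<forall>g'\<in>lifted_code n S C. hdist {1..n} f g' < ?\<gamma> \<longrightarrow> g' = g) \<and>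
      (\<exists>u\<le>T + 300 * ((W + 1) * (k + 1)) * (n + card S). \<exists>M.
        exec R (Seq line_input (Seq P line_output)) (initial_memory ?xs) u M \<and>
        has_output M (enc_word \<alpha> n g))"
    unfolding runs_def by blast
qed

text \<open>A word over \<open>s\<close> is one of \<open>card UNIV ^ card s\<close> functions. With
  the alphabet fixed, a bound on \<open>k_max\<close> thus bounds the exhaustive search in each
  code.\<close>

lemma card_code_le:
  fixes C :: "nat set \<Rightarrow> (nat \<Rightarrow> 'a::finite) set"
  assumes data: "lifted_code_data n S C" and s: "s \<in> S" and k: "card s \<le> k"
  shows "card (C s) \<le> card (UNIV :: 'a set) ^ k"
proof -
  have fin: "finite s" using finite_lifted_code_data(2)[OF data s] by blast
  have "card (C s) \<le> card (s \<rightarrow>\<^sub>E (UNIV :: 'a set))"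
    using data s fin by (intro card_mono finite_PiE) (auto simp: lifted_code_data_def)
  also have "\<dots> = card (UNIV :: 'a set) ^ card s"
    using fin by (simp add: card_PiE)
  also have "\<dots> \<le> card (UNIV :: 'a set) ^ k"
    using k by (intro power_increasing) (auto simp: Suc_le_eq finite_UNIV_card_ge_0)
  finally show ?thesis .
qed

text \<open>The O-notation is expressed by a family indexed by \<open>'i\<close>: the program
  \<open>P\<^sub>C\<close> and the constant \<open>c\<close> are chosen once for all
  instances.\<close>

theorem proposition3p7:
  fixes n :: "'i \<Rightarrow> nat"
    and S :: "'i \<Rightarrow> nat set set"
    and C :: "'i \<Rightarrow> nat set \<Rightarrow> (nat \<Rightarrow> 'a::finite) set"
    and \<eta> :: "'i \<Rightarrow> real"
    and \<alpha> :: "'a \<Rightarrow> nat"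
    and ss :: "'i \<Rightarrow> nat set list"
    and cs :: "'i \<Rightarrow> nat set \<Rightarrow> (nat \<Rightarrow> 'a) list"
    and aux :: "'i \<Rightarrow> nat \<Rightarrow> nat"
    and P\<^sub>L :: program
    and T :: "'i \<Rightarrow> nat"
  assumes "\<And>i. lifted_code_data (n i) (S i) (C i)"
    and "\<And>i s s'. s \<in> S i \<Longrightarrow> s' \<in> S i \<Longrightarrow> card (C i s) = card (C i s')"
    and "\<And>i. 0 \<le> \<eta> i"
    and "\<And>i. ereal (\<eta> i) \<le> code_dist (S i) (line_code (S i) (C i)) / 2"
    and "bij_betw \<alpha> UNIV {0..<card (UNIV :: 'a set)}"
    and "\<And>i. enumerates (ss i) (cs i) (S i) (C i)"
    and "\<And>i. decodes_within (listing_of \<alpha> (n i) (ss i) (cs i) (aux i)) P\<^sub>L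
               (S i) (PiE (S i) (C i)) (line_code (S i) (C i))
               (enc_line_word (ss i) (cs i)) (\<eta> i) (T i)"
  shows "\<exists>P\<^sub>C.
     (\<forall>i. \<exists>t. decodes_within (listing_of \<alpha> (n i) (ss i) (cs i) (aux i)) P\<^sub>C
               {1..n i} ({1..n i} \<rightarrow>\<^sub>E UNIV) (lifted_code (n i) (S i) (C i))
               (enc_word \<alpha> (n i))
               (real (D_min (n i) (S i)) / (real (D_max (n i) (S i)) * real (k_max (S i))) * \<eta> i)
               t) \<and>
     ((\<exists>K. \<forall>i. k_max (S i) \<le> K) \<longrightarrow>
      (\<exists>c. \<forall>i. decodes_within (listing_of \<alpha> (n i) (ss i) (cs i) (aux i)) P\<^sub>C
               {1..n i} ({1..n i} \<rightarrow>\<^sub>E UNIV) (lifted_code (n i) (S i) (C i))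
               (enc_word \<alpha> (n i))
               (real (D_min (n i) (S i)) / (real (D_max (n i) (S i)) * real (k_max (S i))) * \<eta> i)
               (T i + c * (n i + card (S i)))))"
proof (rule exI[of _ "Seq line_input (Seq P\<^sub>L line_output)"])
  let ?P = "Seq line_input (Seq P\<^sub>L line_output)"
  let ?t = "\<lambda>i K. T i + 300 * ((card (UNIV :: 'a set) ^ K + 1) * (K + 1)) * (n i + card (S i))"
  \<comment> \<open>\<open>K\<close> stays a parameter: the choice \<open>K = k_max (S i)\<close>
    bounds the time for each \<open>i\<close>, while a common \<open>K\<close> makes the factor of
    \<open>n i + card (S i)\<close> independent of \<open>i\<close>.\<close>
  have dec: "decodes_within (listing_of \<alpha> (n i) (ss i) (cs i) (aux i)) ?P
      {1..n i} ({1..n i} \<rightarrow>\<^sub>E UNIV) (lifted_code (n i) (S i) (C i)) (enc_word \<alpha> (n i))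
      (real (D_min (n i) (S i)) / (real (D_max (n i) (S i)) * real (k_max (S i))) * \<eta> i)
      (?t i K)" if K: "k_max (S i) \<le> K" for i K
  proof (rule decodes_lifted_code[OF assms(1) _ assms(6) _ _ assms(7)])
    show "inj \<alpha>" using assms(5) by (rule bij_betw_imp_inj_on)
    show k: "card s \<le> K" if "s \<in> S i" for s
    proof -
      have "card s \<le> k_max (S i)"
        using that finite_lifted_code_data(1)[OF assms(1)] by (simp add: k_max_def)
      with K show ?thesis by simp
    qed
    show "card (C i s) \<le> card (UNIV :: 'a set) ^ K" if "s \<in> S i" for s
      by (rule card_code_le[OF assms(1) that k[OF that]])
  qed
  then show "(\<forall>i. \<exists>t. decodes_within (listing_of \<alpha> (n i) (ss i) (cs i) (aux i)) ?P
               {1..n i} ({1..n i} \<rightarrow>\<^sub>E UNIV) (lifted_code (n i) (S i) (C i))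
               (enc_word \<alpha> (n i))
               (real (D_min (n i) (S i)) / (real (D_max (n i) (S i)) * real (k_max (S i))) * \<eta> i)
               t) \<and>
     ((\<exists>K. \<forall>i. k_max (S i) \<le> K) \<longrightarrow>
      (\<exists>c. \<forall>i. decodes_within (listing_of \<alpha> (n i) (ss i) (cs i) (aux i)) ?P
               {1..n i} ({1..n i} \<rightarrow>\<^sub>E UNIV) (lifted_code (n i) (S i) (C i))
               (enc_word \<alpha> (n i))
               (real (D_min (n i) (S i)) / (real (D_max (n i) (S i)) * real (k_max (S i))) * \<eta> i)
               (T i + c * (n i + card (S i)))))"
    by blast
qed

end
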